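(* Let $X$ be a topological space. The restrictions of the topologies $\tau_w$ and $\tau_s$ to $\mathcal{ML}(X)$ coincide.
   Context: No separation axioms are assumed on topological spaces. Compact means that every open cover has a finite subcover (Hausdorff is not required). For a topological space $X$, $\mathcal{F}(X)$ is the set of all closed subsets of $X$ (including $\emptyset$). A subset $L\subset X$ is a limit set if there is a net in $X$ that converges to every point of $L$; equivalently, every finite family of open subsets of $X$ each of which intersects $L$ has nonempty intersection. $\mathcal{ML}(X)$ is the set of all limit sets of $X$ that are maximal with respect to inclusion among limit sets; these are automatically closed, so $\mathcal{ML}(X)\subset\mathcal{F}(X)$. For a compact $C\subset X$ and a finite (possibly empty) family $\Phi$ of open subsets of $X$ put $\mathcal{U}(C,\Phi)=\{A\in\mathcal{F}(X)\mid A\cap C=\emptyset,\ A\cap O\neq\emptyset \text{ for all } O\in\Phi\}$. The Fell topology $\tau_s$ on $\mathcal{F}(X)$ has as a base all the sets $\mathcal{U}(C,\Phi)$ with $C$ compact (possibly empty) and $\Phi$ finite. The lower semifinite topology $\tau_w$ on $\mathcal{F}(X)$ has as a base all the sets $\mathcal{U}(\emptyset,\Phi)$ with $\Phi$ finite. *)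

theory Defs
  imports "HOL-Analysis.Analysis"
begin

definition directed_preorder_on :: "'i set \<Rightarrow> ('i \<Rightarrow> 'i \<Rightarrow> bool) \<Rightarrow> bool" where
  "directed_preorder_on D le \<longleftrightarrow>
     D \<noteq> {} \<and>
     (\<forall>i\<in>D. le i i) \<and>
     (\<forall>i\<in>D. \<forall>j\<in>D. \<forall>k\<in>D. le i j \<longrightarrow> le j k \<longrightarrow> le i k) \<and>
     (\<forall>i\<in>D. \<forall>j\<in>D. \<exists>k\<in>D. le i k \<and> le j k)"

definition tail_filter :: "'i set \<Rightarrow> ('i \<Rightarrow> 'i \<Rightarrow> bool) \<Rightarrow> 'i filter" where
  "tail_filter D le = (INF i\<in>D. principal {j\<in>D. le i j})"

lemma eventually_tail_filter:
  assumes "directed_preorder_on D le"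
  shows "eventually P (tail_filter D le) \<longleftrightarrow> (\<exists>i\<in>D. \<forall>j\<in>D. le i j \<longrightarrow> P j)"
proof -
  have ne: "D \<noteq> {}"
    using assms unfolding directed_preorder_on_def by (elim conjE)
  have trans: "\<forall>i\<in>D. \<forall>j\<in>D. \<forall>k\<in>D. le i j \<longrightarrow> le j k \<longrightarrow> le i k"
    using assms unfolding directed_preorder_on_def by (elim conjE)
  have upper: "\<forall>i\<in>D. \<forall>j\<in>D. \<exists>k\<in>D. le i k \<and> le j k"
    using assms unfolding directed_preorder_on_def by (elim conjE)
  have base: "\<exists>k\<in>D. principal {l\<in>D. le k l}
      \<le> inf (principal {l\<in>D. le i l}) (principal {l\<in>D. le j l})"
    if "i \<in> D" "j \<in> D" for i j
  proof -
    obtain k where k: "k \<in> D" "le i k" "le j k"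
      using bspec[OF bspec[OF upper \<open>i \<in> D\<close>] \<open>j \<in> D\<close>] by (elim bexE conjE)
    have "le i l" "le j l" if "l \<in> D" "le k l" for l
      using trans[rule_format, OF \<open>i \<in> D\<close> k(1) that(1) k(2) that(2)]
        trans[rule_format, OF \<open>j \<in> D\<close> k(1) that(1) k(3) that(2)] by simp_all
    then show ?thesis
      by (intro bexI[of _ k]) (auto simp: k(1))
  qed
  have "eventually P (tail_filter D le) \<longleftrightarrow> (\<exists>i\<in>D. eventually P (principal {j\<in>D. le i j}))"
    unfolding tail_filter_def using ne base by (rule eventually_INF_base)
  then show ?thesis
    by (simp add: eventually_principal Ball_def imp_conjL)
qed

text \<open>The net \<open>x\<close>, indexed by the preordered set \<open>(D, le)\<close>, lies in \<open>X\<close> and converges to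
  every point of \<open>L\<close>.\<close>

definition net_converging_to :: "'a topology \<Rightarrow> 'a set \<Rightarrow> 'i set \<Rightarrow> ('i \<Rightarrow> 'i \<Rightarrow> bool) \<Rightarrow> ('i \<Rightarrow> 'a) \<Rightarrow> bool"
  where
  "net_converging_to X L D le x \<longleftrightarrow>
     directed_preorder_on D le \<and> x ` D \<subseteq> topspace X \<and> (\<forall>l\<in>L. limitin X x l (tail_filter D le))"

text \<open>One cannot quantify existentially over the type of indices.  Directed subsets of
  \<^typ>\<open>'a set\<close> suffice: \<open>limit_setI\<close> below shows that nets over an arbitrary index type yield
  no further limit sets.\<close>

definition limit_set :: "'a topology \<Rightarrow> 'a set \<Rightarrow> bool" where
  "limit_set X L \<longleftrightarrow>
     L \<subseteq> topspace X \<and> (\<exists>(D :: 'a set set) le x. net_converging_to X L D le x)"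

definition maximal_limit_sets :: "'a topology \<Rightarrow> 'a set set" where
  "maximal_limit_sets X = {L. limit_set X L \<and> (\<forall>M. limit_set X M \<longrightarrow> L \<subseteq> M \<longrightarrow> M = L)}"

lemma net_converging_to_finite_family:
  assumes net: "net_converging_to X L D le x"
    and \<Phi>: "finite \<Phi>" "\<forall>O'\<in>\<Phi>. openin X O' \<and> O' \<inter> L \<noteq> {}"
  shows "topspace X \<inter> \<Inter>\<Phi> \<noteq> {}"
proof -
  have dir: "directed_preorder_on D le" and sub: "x ` D \<subseteq> topspace X"
    and lim: "\<And>l. l \<in> L \<Longrightarrow> limitin X x l (tail_filter D le)"
    using net unfolding net_converging_to_def by auto
  have "eventually (\<lambda>i. x i \<in> O') (tail_filter D le)" if "O' \<in> \<Phi>" for O'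
  proof -
    have "openin X O'" "O' \<inter> L \<noteq> {}"
      using bspec[OF \<Phi>(2) that] by simp_all
    then obtain l where "openin X O'" "l \<in> O'" "l \<in> L"
      by fast
    then show ?thesis
      by (intro limitinD[OF lim])
  qed
  then have "eventually (\<lambda>i. \<forall>O'\<in>\<Phi>. x i \<in> O') (tail_filter D le)"
    using \<Phi>(1) by (simp add: eventually_ball_finite)
  then obtain i where i: "i \<in> D" "\<forall>j\<in>D. le i j \<longrightarrow> (\<forall>O'\<in>\<Phi>. x j \<in> O')"
    unfolding eventually_tail_filter[OF dir] by blast
  moreover have "le i i"
    using dir i(1) by (simp add: directed_preorder_on_def)
  ultimately have "i \<in> D" "\<forall>O'\<in>\<Phi>. x i \<in> O'"
    by simp_all
  then have "x i \<in> topspace X \<inter> \<Inter>\<Phi>"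
    using sub by auto
  then show ?thesis by (rule ex_in_conv[THEN iffD1, OF exI])
qed

text \<open>The intersection of the empty family is the whole space.\<close>

lemma limit_set_iff_finite_family:
  "limit_set X L \<longleftrightarrow>
     L \<subseteq> topspace X \<and>
     (\<forall>\<Phi>. finite \<Phi> \<longrightarrow> (\<forall>O'\<in>\<Phi>. openin X O' \<and> O' \<inter> L \<noteq> {}) \<longrightarrow> topspace X \<inter> \<Inter>\<Phi> \<noteq> {})"
proof
  assume "limit_set X L"
  then show "L \<subseteq> topspace X \<and>
     (\<forall>\<Phi>. finite \<Phi> \<longrightarrow> (\<forall>O'\<in>\<Phi>. openin X O' \<and> O' \<inter> L \<noteq> {}) \<longrightarrow> topspace X \<inter> \<Inter>\<Phi> \<noteq> {})"
    unfolding limit_set_def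
  proof (elim conjE exE, intro conjI allI impI)
    fix D :: "'a set set" and le x \<Phi>
    assume "net_converging_to X L D le x" "finite \<Phi>" "\<forall>O'\<in>\<Phi>. openin X O' \<and> O' \<inter> L \<noteq> {}"
    then show "topspace X \<inter> \<Inter>\<Phi> \<noteq> {}"
      by (rule net_converging_to_finite_family)
  qed
next
  assume R: "L \<subseteq> topspace X \<and>
     (\<forall>\<Phi>. finite \<Phi> \<longrightarrow> (\<forall>O'\<in>\<Phi>. openin X O' \<and> O' \<inter> L \<noteq> {}) \<longrightarrow> topspace X \<inter> \<Inter>\<Phi> \<noteq> {})"
  define D where
    "D = (\<lambda>\<Phi>. topspace X \<inter> \<Inter>\<Phi>) ` {\<Phi>. finite \<Phi> \<and> (\<forall>O'\<in>\<Phi>. openin X O' \<and> O' \<inter> L \<noteq> {})}"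
  define x where "x = (\<lambda>U :: 'a set. SOME a. a \<in> U)"
  have "U \<noteq> {}" if "U \<in> D" for U
    using that R unfolding D_def by fastforce
  then have x: "x U \<in> U" if "U \<in> D" for U
    using that unfolding x_def by (simp add: some_in_eq)
  have top: "topspace X \<in> D"
    unfolding D_def by (rule image_eqI[of _ _ "{}"]) auto
  have int: "U \<inter> V \<in> D" if "U \<in> D" "V \<in> D" for U V
  proof -
    obtain \<Phi> where \<Phi>: "U = topspace X \<inter> \<Inter>\<Phi>" "finite \<Phi>"
      "\<forall>O'\<in>\<Phi>. openin X O' \<and> O' \<inter> L \<noteq> {}"
      using \<open>U \<in> D\<close> unfolding D_def by (elim imageE CollectE conjE)
    obtain \<Psi> where \<Psi>: "V = topspace X \<inter> \<Inter>\<Psi>" "finite \<Psi>"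
      "\<forall>O'\<in>\<Psi>. openin X O' \<and> O' \<inter> L \<noteq> {}"
      using \<open>V \<in> D\<close> unfolding D_def by (elim imageE CollectE conjE)
    show ?thesis
      unfolding D_def
    proof (rule image_eqI[of _ _ "\<Phi> \<union> \<Psi>"])
      show "U \<inter> V = topspace X \<inter> \<Inter>(\<Phi> \<union> \<Psi>)"
        using \<Phi>(1) \<Psi>(1) by (simp add: Inter_Un_distrib Int_ac)
      show "\<Phi> \<union> \<Psi> \<in> {\<Phi>. finite \<Phi> \<and> (\<forall>O'\<in>\<Phi>. openin X O' \<and> O' \<inter> L \<noteq> {})}"
        using \<Phi>(2,3) \<Psi>(2,3) by (simp add: ball_Un)
    qed
  qed
  have dir: "directed_preorder_on D (\<lambda>U V. V \<subseteq> U)"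
    unfolding directed_preorder_on_def
  proof (intro conjI ballI)
    fix U V assume "U \<in> D" "V \<in> D"
    then show "\<exists>W\<in>D. W \<subseteq> U \<and> W \<subseteq> V"
      using int[of U V] by blast
  qed (use top in auto)
  have "limitin X x l (tail_filter D (\<lambda>U V. V \<subseteq> U))" if l: "l \<in> L" for l
    unfolding limitin_def eventually_tail_filter[OF dir]
  proof (intro conjI allI impI)
    show "l \<in> topspace X" using l R by blast
    fix U assume U: "openin X U \<and> l \<in> U"
    have "U \<in> D"
      unfolding D_def
    proof (rule image_eqI[of _ _ "{U}"])
      show "U = topspace X \<inter> \<Inter>{U}" using U openin_subset by blast
    qed (use U l in auto)
    then show "\<exists>V\<in>D. \<forall>W\<in>D. W \<subseteq> V \<longrightarrow> x W \<in> U"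
      using x by blast
  qed
  moreover have "x ` D \<subseteq> topspace X"
    using x unfolding D_def by blast
  ultimately have "net_converging_to X L D (\<lambda>U V. V \<subseteq> U) x"
    using dir unfolding net_converging_to_def by blast
  then show "limit_set X L"
    using conjunct1[OF R] unfolding limit_set_def by (intro conjI exI)
qed

lemma limit_setI:
  assumes "L \<subseteq> topspace X" "net_converging_to X L D le x"
  shows "limit_set X L"
  unfolding limit_set_iff_finite_family
proof (intro conjI allI impI)
  fix \<Phi> assume "finite \<Phi>" "\<forall>O'\<in>\<Phi>. openin X O' \<and> O' \<inter> L \<noteq> {}"
  with assms(2) show "topspace X \<inter> \<Inter>\<Phi> \<noteq> {}"
    by (rule net_converging_to_finite_family)
qed (fact assms(1))

lemma maximal_limit_set_closedin:
  assumes "L \<in> maximal_limit_sets X"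
  shows "closedin X L"
proof -
  have L: "limit_set X L" and max: "\<And>M. limit_set X M \<Longrightarrow> L \<subseteq> M \<Longrightarrow> M = L"
    using assms unfolding maximal_limit_sets_def by auto
  have sub: "L \<subseteq> topspace X"
    using L unfolding limit_set_def by blast
  have "limit_set X (X closure_of L)"
    unfolding limit_set_iff_finite_family
  proof (intro conjI allI impI)
    fix \<Phi> assume fin: "finite \<Phi>" and \<Phi>: "\<forall>O'\<in>\<Phi>. openin X O' \<and> O' \<inter> X closure_of L \<noteq> {}"
    from \<Phi> have "\<forall>O'\<in>\<Phi>. openin X O' \<and> O' \<inter> L \<noteq> {}"
      by (metis openin_Int_closure_of_eq_empty)
    with fin show "topspace X \<inter> \<Inter>\<Phi> \<noteq> {}"
      using L[unfolded limit_set_iff_finite_family] by simp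
  qed (simp add: closure_of_subset_topspace)
  then have "X closure_of L = L"
    using max closure_of_subset[OF sub] by blast
  then show ?thesis
    by (simp add: closure_of_eq)
qed

definition fell_basic :: "'a topology \<Rightarrow> 'a set \<Rightarrow> 'a set set \<Rightarrow> 'a set set" where
  "fell_basic X C \<Phi> = {A. closedin X A \<and> A \<inter> C = {} \<and> (\<forall>O'\<in>\<Phi>. A \<inter> O' \<noteq> {})}"

text \<open>Both hyperspace topologies have as carrier the set of all closed subsets of \<open>X\<close>.\<close>

definition fell_topology :: "'a topology \<Rightarrow> 'a set topology" where
  "fell_topology X = topology (arbitrary union_of
     (\<lambda>\<U>. \<exists>C \<Phi>. compactin X C \<and> finite \<Phi> \<and> (\<forall>O'\<in>\<Phi>. openin X O') \<and> \<U> = fell_basic X C \<Phi>))"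

definition lower_semifinite_topology :: "'a topology \<Rightarrow> 'a set topology" where
  "lower_semifinite_topology X = topology (arbitrary union_of
     (\<lambda>\<U>. \<exists>\<Phi>. finite \<Phi> \<and> (\<forall>O'\<in>\<Phi>. openin X O') \<and> \<U> = fell_basic X {} \<Phi>))"

lemma fell_basic_Int: "fell_basic X C \<Phi> \<inter> fell_basic X C' \<Psi> = fell_basic X (C \<union> C') (\<Phi> \<union> \<Psi>)"
  unfolding fell_basic_def by blast

lemma openin_fell_topology:
  "openin (fell_topology X) = arbitrary union_of
     (\<lambda>\<U>. \<exists>C \<Phi>. compactin X C \<and> finite \<Phi> \<and> (\<forall>O'\<in>\<Phi>. openin X O') \<and> \<U> = fell_basic X C \<Phi>)"
  unfolding fell_topology_def
proof (rule topology_inverse', rule istopology_base, elim exE conjE)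
  fix S T C \<Phi> C' \<Psi>
  assume "compactin X C" "finite \<Phi>" "\<forall>O'\<in>\<Phi>. openin X O'" "S = fell_basic X C \<Phi>"
    "compactin X C'" "finite \<Psi>" "\<forall>O'\<in>\<Psi>. openin X O'" "T = fell_basic X C' \<Psi>"
  then show "\<exists>C \<Phi>. compactin X C \<and> finite \<Phi> \<and> (\<forall>O'\<in>\<Phi>. openin X O') \<and> S \<inter> T = fell_basic X C \<Phi>"
    by (intro exI[of _ "C \<union> C'"] exI[of _ "\<Phi> \<union> \<Psi>"]) (auto simp: fell_basic_Int compactin_Un)
qed

lemma openin_lower_semifinite_topology:
  "openin (lower_semifinite_topology X) = arbitrary union_of
     (\<lambda>\<U>. \<exists>\<Phi>. finite \<Phi> \<and> (\<forall>O'\<in>\<Phi>. openin X O') \<and> \<U> = fell_basic X {} \<Phi>)"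
  unfolding lower_semifinite_topology_def
proof (rule topology_inverse', rule istopology_base, elim exE conjE)
  fix S T \<Phi> \<Psi>
  assume "finite \<Phi>" "\<forall>O'\<in>\<Phi>. openin X O'" "S = fell_basic X {} \<Phi>"
    "finite \<Psi>" "\<forall>O'\<in>\<Psi>. openin X O'" "T = fell_basic X {} \<Psi>"
  then show "\<exists>\<Phi>. finite \<Phi> \<and> (\<forall>O'\<in>\<Phi>. openin X O') \<and> S \<inter> T = fell_basic X {} \<Phi>"
    by (intro exI[of _ "\<Phi> \<union> \<Psi>"]) (auto simp: fell_basic_Int)
qed

lemma topspace_fell_topology: "topspace (fell_topology X) = {A. closedin X A}"
proof -
  have "openin (fell_topology X) (fell_basic X {} {})"
    unfolding openin_fell_topology
    by (rule arbitrary_union_of_inc) (use compactin_empty in blast)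
  then have "{A. closedin X A} \<subseteq> topspace (fell_topology X)"
    using openin_subset by (fastforce simp: fell_basic_def)
  moreover have "topspace (fell_topology X) \<subseteq> {A. closedin X A}"
    using openin_topspace[of "fell_topology X"]
    unfolding openin_fell_topology arbitrary_union_of_alt fell_basic_def by blast
  ultimately show ?thesis by blast
qed

lemma topspace_lower_semifinite_topology:
  "topspace (lower_semifinite_topology X) = {A. closedin X A}"
proof -
  have "openin (lower_semifinite_topology X) (fell_basic X {} {})"
    unfolding openin_lower_semifinite_topology
    by (rule arbitrary_union_of_inc) blast
  then have "{A. closedin X A} \<subseteq> topspace (lower_semifinite_topology X)"
    using openin_subset by (fastforce simp: fell_basic_def)
  moreover have "topspace (lower_semifinite_topology X) \<subseteq> {A. closedin X A}"
    using openin_topspace[of "lower_semifinite_topology X"]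
    unfolding openin_lower_semifinite_topology arbitrary_union_of_alt fell_basic_def by blast
  ultimately show ?thesis by blast
qed

end

theory Submission
  imports Defs
begin

text \<open>A point \<open>c\<close> outside a maximal limit set \<open>A\<close> cannot be added to it, so some open neighbourhood
  of \<open>c\<close> has empty intersection with finitely many open sets that meet \<open>A\<close>.  A limit set meeting
  the latter then misses the neighbourhood.  By compactness, missing a compact set \<open>C\<close> is thus
  implied, near \<open>A\<close> and among limit sets, by hitting finitely many open sets.\<close>

lemma limit_set_finite_Inter:
  assumes "limit_set X L" "finite \<Phi>" "\<And>U. U \<in> \<Phi> \<Longrightarrow> openin X U" "\<And>U. U \<in> \<Phi> \<Longrightarrow> L \<inter> U \<noteq> {}"
  shows "topspace X \<inter> \<Inter>\<Phi> \<noteq> {}"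
proof -
  have "\<forall>U\<in>\<Phi>. openin X U \<and> U \<inter> L \<noteq> {}"
    using assms(3,4) by (simp add: Int_commute)
  then show ?thesis
    using assms(1,2) unfolding limit_set_iff_finite_family by blast
qed

text \<open>Maximality is used only here: it forbids \<open>insert c A\<close> to be a limit set, so
  the finite-family criterion fails for some \<open>\<Phi>\<close>. Sorting the members of
  \<open>\<Phi>\<close> by whether they contain \<open>c\<close> or meet \<open>A\<close> yields the
  neighbourhood and the family.\<close>

lemma maximal_limit_set_separate_point:
  assumes A: "A \<in> maximal_limit_sets X" and c: "c \<in> topspace X" "c \<notin> A"
  shows "\<exists>V \<Phi>. openin X V \<and> c \<in> V \<and> finite \<Phi> \<and> (\<forall>U\<in>\<Phi>. openin X U \<and> A \<inter> U \<noteq> {})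
    \<and> V \<inter> \<Inter>\<Phi> = {}"
proof -
  have "A \<subseteq> topspace X" "\<not> limit_set X (insert c A)"
    using A c(2) unfolding maximal_limit_sets_def limit_set_def by blast+
  then obtain \<Phi> where \<Phi>: "finite \<Phi>" "\<And>U. U \<in> \<Phi> \<Longrightarrow> openin X U"
    "\<And>U. U \<in> \<Phi> \<Longrightarrow> U \<inter> insert c A \<noteq> {}" "topspace X \<inter> \<Inter>\<Phi> = {}"
    using c(1) unfolding limit_set_iff_finite_family by auto
  \<comment> \<open>The factor \<open>topspace X\<close> keeps \<open>V\<close> open in
    \<open>X\<close> even if no member of \<open>\<Phi>\<close> contains \<open>c\<close>, when the
    intersection over the empty family is \<open>UNIV\<close>.\<close>
  define V where "V = topspace X \<inter> \<Inter>{U \<in> \<Phi>. c \<in> U}"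
  have "openin X V"
    unfolding V_def using \<Phi>(1,2) by (intro openin_Int_Inter) auto
  \<comment> \<open>Each member of \<open>\<Phi>\<close> contains \<open>c\<close> or meets
    \<open>A\<close>, so a common point of both sides would lie in
    \<open>topspace X \<inter> \<Inter>\<Phi>\<close>.\<close>
  moreover have "V \<inter> \<Inter>{U \<in> \<Phi>. A \<inter> U \<noteq> {}} = {}"
    using \<Phi>(3,4) unfolding V_def by fast
  ultimately show ?thesis
    using \<Phi>(1,2) c(1)
    by (intro exI[of _ V] exI[of _ "{U \<in> \<Phi>. A \<inter> U \<noteq> {}}"]) (auto simp: V_def)
qed

text \<open>Finitely many of the neighbourhoods \<open>V c\<close> cover \<open>C\<close>, and the
  union of their families \<open>\<Phi> c\<close> serves as \<open>\<Psi>\<close>. It trades the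
  condition of missing \<open>C\<close> for finitely many hitting conditions, the only kind that the
  lower semifinite topology can express.\<close>

lemma maximal_limit_set_separate_compact:
  assumes A: "A \<in> maximal_limit_sets X" and C: "compactin X C" "A \<inter> C = {}"
  obtains \<Psi> where "finite \<Psi>" "\<And>U. U \<in> \<Psi> \<Longrightarrow> openin X U" "\<And>U. U \<in> \<Psi> \<Longrightarrow> A \<inter> U \<noteq> {}"
    "\<And>B. limit_set X B \<Longrightarrow> (\<And>U. U \<in> \<Psi> \<Longrightarrow> B \<inter> U \<noteq> {}) \<Longrightarrow> B \<inter> C = {}"
proof -
  have "\<forall>c\<in>C. \<exists>V \<Phi>. openin X V \<and> c \<in> V \<and> finite \<Phi> \<and> (\<forall>U\<in>\<Phi>. openin X U \<and> A \<inter> U \<noteq> {})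
      \<and> V \<inter> \<Inter>\<Phi> = {}"
    using compactin_subset_topspace[OF C(1)] C(2)
    by (intro ballI maximal_limit_set_separate_point[OF A]) auto
  then obtain V \<Phi> where sep: "\<forall>c\<in>C. openin X (V c) \<and> c \<in> V c \<and> finite (\<Phi> c)
      \<and> (\<forall>U\<in>\<Phi> c. openin X U \<and> A \<inter> U \<noteq> {}) \<and> V c \<inter> \<Inter>(\<Phi> c) = {}"
    unfolding bchoice_iff by (elim exE)
  then have V: "\<And>c. c \<in> C \<Longrightarrow> openin X (V c)" "\<And>c. c \<in> C \<Longrightarrow> c \<in> V c"
    and \<Phi>: "\<And>c. c \<in> C \<Longrightarrow> finite (\<Phi> c)" "\<And>c U. c \<in> C \<Longrightarrow> U \<in> \<Phi> c \<Longrightarrow> openin X U"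
      "\<And>c U. c \<in> C \<Longrightarrow> U \<in> \<Phi> c \<Longrightarrow> A \<inter> U \<noteq> {}" "\<And>c. c \<in> C \<Longrightarrow> V c \<inter> \<Inter>(\<Phi> c) = {}"
    by simp_all
  obtain \<F> where "finite \<F>" "\<F> \<subseteq> V ` C" "C \<subseteq> \<Union>\<F>"
    using compactinD[OF C(1), of "V ` C"] V by blast
  then obtain F where F: "finite F" "F \<subseteq> C" "C \<subseteq> \<Union>(V ` F)"
    by (metis finite_subset_image)
  show ?thesis
  proof (rule that[of "\<Union>(\<Phi> ` F)"])
    fix B assume B: "limit_set X B" and hit: "\<And>U. U \<in> \<Union>(\<Phi> ` F) \<Longrightarrow> B \<inter> U \<noteq> {}"
    show "B \<inter> C = {}"
    proof (rule ccontr)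
      assume "B \<inter> C \<noteq> {}"
      then obtain b c where b: "b \<in> B" "b \<in> V c" and c: "c \<in> F" "c \<in> C"
        using F by blast
      \<comment> \<open>The limit set \<open>B\<close> meets \<open>V c\<close> in \<open>b\<close>
        and the members of \<open>\<Phi> c\<close> by \<open>hit\<close>, so these finitely many
        open sets must share a point, although \<open>V c\<close> and \<open>\<Phi> c\<close> were
        chosen to have none in common.\<close>
      have "topspace X \<inter> \<Inter>(insert (V c) (\<Phi> c)) \<noteq> {}"
        using B b c hit V \<Phi> by (intro limit_set_finite_Inter[of X B]) auto
      then show False
        using \<Phi>(4)[OF c(2)] by auto
    qed
  qed (use F \<Phi> in auto)
qed

lemma openin_fell_basic_lower_semifinite:
  assumes "finite \<Phi>" "\<And>U. U \<in> \<Phi> \<Longrightarrow> openin X U"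
  shows "openin (lower_semifinite_topology X) (fell_basic X {} \<Phi>)"
  unfolding openin_lower_semifinite_topology
  by (rule arbitrary_union_of_inc, rule exI[of _ \<Phi>]) (simp add: assms)

lemma openin_fell_basic_fell:
  assumes "compactin X C" "finite \<Phi>" "\<And>U. U \<in> \<Phi> \<Longrightarrow> openin X U"
  shows "openin (fell_topology X) (fell_basic X C \<Phi>)"
  unfolding openin_fell_topology
  by (rule arbitrary_union_of_inc, rule exI[of _ C], rule exI[of _ \<Phi>]) (simp add: assms)

text \<open>The empty set is compact, so every basic set of the lower semifinite topology is a basic
  set of the Fell topology.\<close>

lemma openin_fell_if_openin_lower_semifinite:
  assumes "openin (lower_semifinite_topology X) S"
  shows "openin (fell_topology X) S"
proof -
  obtain \<B> where \<B>: "S = \<Union>\<B>"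
    "\<And>T. T \<in> \<B> \<Longrightarrow> \<exists>\<Phi>. finite \<Phi> \<and> (\<forall>U\<in>\<Phi>. openin X U) \<and> T = fell_basic X {} \<Phi>"
    using assms unfolding openin_lower_semifinite_topology union_of_def by auto
  have "openin (fell_topology X) T" if "T \<in> \<B>" for T
    using \<B>(2)[OF that] by (elim exE conjE) (simp add: openin_fell_basic_fell)
  then show ?thesis
    unfolding \<B>(1) by (rule openin_Union)
qed

lemma fell_basic_neighbourhood:
  assumes "openin (fell_topology X) S" "A \<in> S"
  obtains C \<Phi> where "compactin X C" "finite \<Phi>" "\<And>U. U \<in> \<Phi> \<Longrightarrow> openin X U"
    "A \<in> fell_basic X C \<Phi>" "fell_basic X C \<Phi> \<subseteq> S"
proof -
  obtain T C \<Phi> where "A \<in> T" "T \<subseteq> S" "compactin X C" "finite \<Phi>" "\<forall>U\<in>\<Phi>. openin X U"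
    "T = fell_basic X C \<Phi>"
    using bspec[OF assms(1)[unfolded openin_fell_topology arbitrary_union_of_alt] assms(2)]
    by (elim exE conjE)
  then show ?thesis
    by (intro that[of C \<Phi>]) simp_all
qed

text \<open>The argument is local, because the family replacing the compact set depends on the point
  \<open>A\<close>.\<close>

lemma openin_lower_semifinite_if_openin_fell:
  assumes S: "openin (fell_topology X) S"
  shows "openin (subtopology (lower_semifinite_topology X) (maximal_limit_sets X))
    (S \<inter> maximal_limit_sets X)"
proof (subst openin_subopen, rule ballI)
  fix A assume A: "A \<in> S \<inter> maximal_limit_sets X"
  then obtain C \<Phi> where C: "compactin X C" and \<Phi>: "finite \<Phi>" "\<And>U. U \<in> \<Phi> \<Longrightarrow> openin X U"
    and sub: "A \<in> fell_basic X C \<Phi>" "fell_basic X C \<Phi> \<subseteq> S"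
    using fell_basic_neighbourhood[OF S, of A] by (elim IntE) metis
  have "A \<in> maximal_limit_sets X" "A \<inter> C = {}"
    using A sub(1) unfolding fell_basic_def by blast+
  then obtain \<Psi> where \<Psi>: "finite \<Psi>" "\<And>U. U \<in> \<Psi> \<Longrightarrow> openin X U" "\<And>U. U \<in> \<Psi> \<Longrightarrow> A \<inter> U \<noteq> {}"
    "\<And>B. limit_set X B \<Longrightarrow> (\<And>U. U \<in> \<Psi> \<Longrightarrow> B \<inter> U \<noteq> {}) \<Longrightarrow> B \<inter> C = {}"
    using maximal_limit_set_separate_compact[OF _ C] by metis
  \<comment> \<open>\<open>\<Phi>\<close> keeps the original hitting conditions, while
    \<open>\<Psi>\<close> replaces \<open>C\<close>: limit sets in \<open>?T\<close> hit all of
    \<open>\<Psi>\<close> and hence miss \<open>C\<close>.\<close>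
  let ?T = "fell_basic X {} (\<Phi> \<union> \<Psi>)"
  have "openin (lower_semifinite_topology X) ?T"
    using \<Phi> \<Psi> by (intro openin_fell_basic_lower_semifinite) auto
  then have "openin (subtopology (lower_semifinite_topology X) (maximal_limit_sets X))
      (?T \<inter> maximal_limit_sets X)"
    unfolding openin_subtopology by blast
  moreover have "A \<in> ?T"
    using sub(1) \<Psi>(3) unfolding fell_basic_def by auto
  moreover have "?T \<inter> maximal_limit_sets X \<subseteq> fell_basic X C \<Phi>"
    using \<Psi>(4) unfolding fell_basic_def maximal_limit_sets_def by auto
  ultimately show "\<exists>T. openin (subtopology (lower_semifinite_topology X) (maximal_limit_sets X)) T
      \<and> A \<in> T \<and> T \<subseteq> S \<inter> maximal_limit_sets X"
    using A sub(2) by blast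
qed

theorem corollary4p2:
  fixes X :: "'a topology"
  shows "subtopology (lower_semifinite_topology X) (maximal_limit_sets X)
       = subtopology (fell_topology X) (maximal_limit_sets X)"
  unfolding topology_eq
proof (intro allI iffI)
  fix S
  assume "openin (subtopology (lower_semifinite_topology X) (maximal_limit_sets X)) S"
  \<comment> \<open>This inclusion holds already on the whole hyperspace and passes to
    traces.\<close>
  then show "openin (subtopology (fell_topology X) (maximal_limit_sets X)) S"
    unfolding openin_subtopology using openin_fell_if_openin_lower_semifinite by blast
next
  fix S
  assume "openin (subtopology (fell_topology X) (maximal_limit_sets X)) S"
  then obtain T where "openin (fell_topology X) T" "S = T \<inter> maximal_limit_sets X"
    unfolding openin_subtopology by blast
  then show "openin (subtopology (lower_semifinite_topology X) (maximal_limit_sets X)) S"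
    by (simp add: openin_lower_semifinite_if_openin_fell)
qed

end
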